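(* $\overline{\mathcal{G}_{\mathcal{A}}}=\overline{\mathcal{G}_\infty}$, where closures are taken in the space of analytic functions on $\mathbb{C}_+$ with the topology of uniform convergence on compact subsets of $\mathbb{C}_+$.
   Context: $\mathbb{N}=\{1,2,\dots\}$. For $\theta\in\mathbb{R}$, $\mathbb{C}_\theta=\{s\in\mathbb{C}:\mathrm{Re}(s)>\theta\}$ and $\mathbb{C}_+=\mathbb{C}_0$. $\mathcal{D}$ is the set of Dirichlet series $\sum_{n\ge1}a_nn^{-s}$ that converge in some half-plane $\mathbb{C}_\theta$; an analytic function on $\mathbb{C}_+$ is said to be in $\mathcal{D}$ if it coincides with such a series on some half-plane. An analytic $\Phi:\mathbb{C}_+\to\mathbb{C}_+$ is in $\mathcal{G}_\infty$ if there are $c_\Phi\in\mathbb{N}\cup\{0\}$ and $\varphi\in\mathcal{D}$ with $\Phi(s)=c_\Phi s+\varphi(s)$. It is in $\mathcal{G}_{\mathcal{A}}$ if $\Phi\in\mathcal{G}_\infty$ and, for every $M>0$, $\Phi$ is uniformly continuous on $A_M=\{s\in\mathbb{C}_+:0<\mathrm{Re}(\Phi(s))<M\}$. *)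

theory Defs
  imports "HOL-Complex_Analysis.Complex_Analysis"
begin

definition half_plane :: "real \<Rightarrow> complex set" where
  "half_plane \<theta> = {s. Re s > \<theta>}"

abbreviation C_plus :: "complex set" where
  "C_plus \<equiv> half_plane 0"

text \<open>
  Functions with domain \<open>C_plus\<close> are represented as extensional total functions (equal to
  \<open>undefined\<close> outside \<open>C_plus\<close>), so that HOL equality is equality of functions on \<open>C_plus\<close>.
\<close>

definition analytic_space :: "(complex \<Rightarrow> complex) set" where
  "analytic_space = {f \<in> extensional C_plus. f analytic_on C_plus}"

text \<open>
  A set is open when around each of its points \<open>f\<close> it contains a basic neighbourhood
  \<open>{g. \<forall>s\<in>K. dist (g s) (f s) < e}\<close> with \<open>K\<close> a compact subset of \<open>C_plus\<close>.  (A finite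
  intersection of basic neighbourhoods of \<open>f\<close> contains another one.)
\<close>

definition compact_convergence_open :: "(complex \<Rightarrow> complex) set \<Rightarrow> bool" where
  "compact_convergence_open U \<longleftrightarrow> U \<subseteq> analytic_space \<and>
     (\<forall>f\<in>U. \<exists>K e. compact K \<and> K \<subseteq> C_plus \<and> e > 0 \<and>
        (\<forall>g\<in>analytic_space. (\<forall>s\<in>K. dist (g s) (f s) < e) \<longrightarrow> g \<in> U))"

definition compact_convergence :: "(complex \<Rightarrow> complex) topology" where
  "compact_convergence = topology compact_convergence_open"

text \<open>
  Analytic functions on \<open>C_plus\<close> that coincide on some half-plane with a Dirichlet series
  \<open>\<Sum>n\<ge>1. a n * n powr (-s)\<close> converging (possibly only conditionally) there.  The summation
  index is shifted by one, so \<open>a 0\<close> plays no role.  Taking \<open>\<theta> \<ge> 0\<close> just keeps the half-plane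
  inside the domain \<open>C_plus\<close>.
\<close>

definition Dirichlet_class :: "(complex \<Rightarrow> complex) set" where
  "Dirichlet_class = {\<phi> \<in> analytic_space. \<exists>(a :: nat \<Rightarrow> complex) \<theta>. \<theta> \<ge> 0 \<and>
     (\<forall>s\<in>half_plane \<theta>. (\<lambda>n. a (Suc n) * of_nat (Suc n) powr (- s)) sums \<phi> s)}"

definition G_infinity :: "(complex \<Rightarrow> complex) set" where
  "G_infinity = {\<Phi> \<in> analytic_space. \<Phi> ` C_plus \<subseteq> C_plus \<and>
     (\<exists>(c :: nat). \<exists>\<phi>\<in>Dirichlet_class. \<forall>s\<in>C_plus. \<Phi> s = of_nat c * s + \<phi> s)}"

definition G_A :: "(complex \<Rightarrow> complex) set" where
  "G_A = {\<Phi> \<in> G_infinity. \<forall>M>0.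
     uniformly_continuous_on {s \<in> C_plus. 0 < Re (\<Phi> s) \<and> Re (\<Phi> s) < M} \<Phi>}"

lemma istopology_compact_convergence_open: "istopology compact_convergence_open"
  unfolding istopology_def
proof (intro conjI allI impI)
  fix S T assume S: "compact_convergence_open S" and T: "compact_convergence_open T"
  show "compact_convergence_open (S \<inter> T)"
    unfolding compact_convergence_open_def
  proof (intro conjI ballI)
    show "S \<inter> T \<subseteq> analytic_space"
      using S by (auto simp: compact_convergence_open_def)
    fix f assume f: "f \<in> S \<inter> T"
    obtain K d where K: "compact K" "K \<subseteq> C_plus" "d > 0"
      "\<And>g. g \<in> analytic_space \<Longrightarrow> (\<forall>s\<in>K. dist (g s) (f s) < d) \<Longrightarrow> g \<in> S"
      using S f unfolding compact_convergence_open_def by (metis IntD1)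
    obtain L e where L: "compact L" "L \<subseteq> C_plus" "e > 0"
      "\<And>g. g \<in> analytic_space \<Longrightarrow> (\<forall>s\<in>L. dist (g s) (f s) < e) \<Longrightarrow> g \<in> T"
      using T f unfolding compact_convergence_open_def by (metis IntD2)
    show "\<exists>K e. compact K \<and> K \<subseteq> C_plus \<and> e > 0 \<and>
        (\<forall>g\<in>analytic_space. (\<forall>s\<in>K. dist (g s) (f s) < e) \<longrightarrow> g \<in> S \<inter> T)"
      by (rule exI[of _ "K \<union> L"], rule exI[of _ "min d e"]) (use K L in \<open>auto simp: compact_Un\<close>)
  qed
next
  fix \<U> assume U: "\<forall>S\<in>\<U>. compact_convergence_open S"
  show "compact_convergence_open (\<Union>\<U>)"
    unfolding compact_convergence_open_def
  proof (intro conjI ballI)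
    show "\<Union>\<U> \<subseteq> analytic_space"
      using U by (auto simp: compact_convergence_open_def)
    fix f assume "f \<in> \<Union>\<U>"
    then obtain S where S: "S \<in> \<U>" "f \<in> S" by blast
    then obtain K e where "compact K" "K \<subseteq> C_plus" "e > 0"
      "\<And>g. g \<in> analytic_space \<Longrightarrow> (\<forall>s\<in>K. dist (g s) (f s) < e) \<Longrightarrow> g \<in> S"
      using U unfolding compact_convergence_open_def by metis
    then show "\<exists>K e. compact K \<and> K \<subseteq> C_plus \<and> e > 0 \<and>
        (\<forall>g\<in>analytic_space. (\<forall>s\<in>K. dist (g s) (f s) < e) \<longrightarrow> g \<in> \<Union>\<U>)"
      using S by blast
  qed
qed

lemma openin_compact_convergence: "openin compact_convergence = compact_convergence_open"
  unfolding compact_convergence_def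
  using istopology_compact_convergence_open by (rule topology_inverse')

lemma topspace_compact_convergence: "topspace compact_convergence = analytic_space"
proof
  show "topspace compact_convergence \<subseteq> analytic_space"
    using openin_topspace[of compact_convergence]
    by (simp add: openin_compact_convergence compact_convergence_open_def)
  have "compact_convergence_open analytic_space"
    unfolding compact_convergence_open_def
    by (intro conjI ballI exI[of _ "{}"] exI[of _ 1]) auto
  then show "analytic_space \<subseteq> topspace compact_convergence"
    by (simp add: openin_subset openin_compact_convergence)
qed

lemma compact_convergence_nbhd:
  assumes f: "f \<in> analytic_space" and K: "compact K" "K \<subseteq> C_plus" and e: "e > 0"
  obtains U where "openin compact_convergence U" "f \<in> U" "\<And>g. g \<in> U \<Longrightarrow> \<forall>s\<in>K. dist (g s) (f s) < e"
proof
  define U where "U = {g \<in> analytic_space. \<exists>d<e. \<forall>s\<in>K. dist (g s) (f s) \<le> d}"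
  show "openin compact_convergence U"
    unfolding openin_compact_convergence compact_convergence_open_def
  proof (intro conjI ballI)
    show "U \<subseteq> analytic_space" by (auto simp: U_def)
    fix g assume "g \<in> U"
    then obtain d where d: "d < e" "\<And>s. s \<in> K \<Longrightarrow> dist (g s) (f s) \<le> d" by (auto simp: U_def)
    have "h \<in> U" if h: "h \<in> analytic_space" "\<forall>s\<in>K. dist (h s) (g s) < (e - d) / 2" for h
    proof -
      have "dist (h s) (f s) \<le> (e + d) / 2" if "s \<in> K" for s
      proof -
        have "dist (h s) (f s) \<le> dist (h s) (g s) + dist (g s) (f s)" by (rule dist_triangle)
        also have "\<dots> \<le> (e - d) / 2 + d" using h(2) d(2) that by (intro add_mono) (auto simp: less_imp_le)
        also have "\<dots> = (e + d) / 2" by (simp add: field_simps)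
        finally show ?thesis .
      qed
      moreover have "(e + d) / 2 < e" using d(1) by simp
      ultimately show ?thesis using h(1) unfolding U_def by blast
    qed
    then show "\<exists>K e. compact K \<and> K \<subseteq> C_plus \<and> e > 0 \<and>
        (\<forall>h\<in>analytic_space. (\<forall>s\<in>K. dist (h s) (g s) < e) \<longrightarrow> h \<in> U)"
      using K d(1) by (intro exI[of _ K] exI[of _ "(e - d) / 2"]) auto
  qed
  show "f \<in> U" using f e by (auto simp: U_def)
  show "\<And>g. g \<in> U \<Longrightarrow> \<forall>s\<in>K. dist (g s) (f s) < e" by (force simp: U_def)
qed

text \<open>Convergence in this topology is uniform convergence on the compact subsets of \<open>C_plus\<close>.\<close>

lemma limitin_compact_convergence:
  "limitin compact_convergence f l F \<longleftrightarrow>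
     l \<in> analytic_space \<and> eventually (\<lambda>x. f x \<in> analytic_space) F \<and>
     (\<forall>K. compact K \<and> K \<subseteq> C_plus \<longrightarrow> uniform_limit K f l F)"
  (is "?L \<longleftrightarrow> ?R")
proof
  assume L: ?L
  then have l: "l \<in> analytic_space"
    by (simp add: limitin_def topspace_compact_convergence)
  have "openin compact_convergence analytic_space"
    using openin_topspace[of compact_convergence] by (simp add: topspace_compact_convergence)
  then have ev: "eventually (\<lambda>x. f x \<in> analytic_space) F"
    using L l by (simp add: limitin_def)
  have "uniform_limit K f l F" if K: "compact K" "K \<subseteq> C_plus" for K
    unfolding uniform_limit_iff
  proof (intro allI impI)
    fix e :: real assume "e > 0"
    then obtain U where U: "openin compact_convergence U" "l \<in> U"
      "\<And>g. g \<in> U \<Longrightarrow> \<forall>s\<in>K. dist (g s) (l s) < e"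
      using compact_convergence_nbhd l K by metis
    then have "eventually (\<lambda>x. f x \<in> U) F" using L by (simp add: limitin_def)
    then show "\<forall>\<^sub>F x in F. \<forall>s\<in>K. dist (f x s) (l s) < e"
      by (rule eventually_mono) (use U(3) in blast)
  qed
  then show ?R using l ev by blast
next
  assume R: ?R
  show ?L
    unfolding limitin_def topspace_compact_convergence
  proof (intro conjI allI impI)
    show "l \<in> analytic_space" using R by blast
    fix U assume "openin compact_convergence U \<and> l \<in> U"
    then obtain K e where K: "compact K" "K \<subseteq> C_plus" "e > 0"
      and U: "\<And>g. g \<in> analytic_space \<Longrightarrow> (\<forall>s\<in>K. dist (g s) (l s) < e) \<Longrightarrow> g \<in> U"
      unfolding openin_compact_convergence compact_convergence_open_def by metis
    have "\<forall>\<^sub>F x in F. \<forall>s\<in>K. dist (f x s) (l s) < e"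
      using R K unfolding uniform_limit_iff by blast
    moreover have "eventually (\<lambda>x. f x \<in> analytic_space) F" using R by blast
    ultimately show "\<forall>\<^sub>F x in F. f x \<in> U"
      by eventually_elim (use U in blast)
  qed
qed

lemma in_closure_of_compact_convergence:
  "f \<in> compact_convergence closure_of S \<longleftrightarrow> f \<in> analytic_space \<and>
     (\<forall>K e. compact K \<and> K \<subseteq> C_plus \<and> e > 0 \<longrightarrow>
        (\<exists>g\<in>S \<inter> analytic_space. \<forall>s\<in>K. dist (g s) (f s) < e))"
  (is "?L \<longleftrightarrow> ?R")
proof
  assume L: ?L
  then have f: "f \<in> analytic_space"
    by (simp add: in_closure_of topspace_compact_convergence)
  have "\<exists>g\<in>S \<inter> analytic_space. \<forall>s\<in>K. dist (g s) (f s) < e"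
    if K: "compact K" "K \<subseteq> C_plus" "e > 0" for K e
  proof -
    obtain U where U: "openin compact_convergence U" "f \<in> U"
      "\<And>g. g \<in> U \<Longrightarrow> \<forall>s\<in>K. dist (g s) (f s) < e"
      using compact_convergence_nbhd f K by metis
    then obtain g where "g \<in> S" "g \<in> U" using L by (auto simp: in_closure_of)
    then show ?thesis
      using U openin_subset[OF U(1)] by (auto simp: topspace_compact_convergence)
  qed
  then show ?R using f by blast
next
  assume R: ?R
  show ?L
    unfolding in_closure_of topspace_compact_convergence
  proof (intro conjI allI impI)
    show "f \<in> analytic_space" using R by blast
    fix U assume "f \<in> U \<and> openin compact_convergence U"
    then obtain K e where K: "compact K" "K \<subseteq> C_plus" "e > 0"
      and U: "\<And>g. g \<in> analytic_space \<Longrightarrow> (\<forall>s\<in>K. dist (g s) (f s) < e) \<Longrightarrow> g \<in> U"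
      unfolding openin_compact_convergence compact_convergence_open_def by metis
    then obtain g where "g \<in> S \<inter> analytic_space" "\<forall>s\<in>K. dist (g s) (f s) < e"
      using R by meson
    then show "\<exists>y. y \<in> S \<and> y \<in> U" using U by blast
  qed
qed

end

theory Submission
  imports Defs
begin

text \<open>
  A map \<open>\<Phi>\<close> of \<open>G_infinity\<close> is the locally uniform limit of its translates \<open>\<Phi> (s + \<delta>)\<close> as
  \<open>\<delta> \<rightarrow> 0\<close>, and translation preserves the Dirichlet series form.  Every point of \<open>C_plus\<close>, once
  translated, is the centre of a disc of fixed radius \<open>\<delta>\<close> on which \<open>\<Phi>\<close> has positive real part, so
  the Schwarz lemma controls the oscillation of the translate near \<open>s\<close> by the real part of its value
  at \<open>s\<close> alone. On \<open>A_M\<close> that real part is less than \<open>M\<close>.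
\<close>

lemma open_half_plane [simp]: "open (half_plane \<theta>)"
  unfolding half_plane_def by (simp add: open_halfspace_Re_gt)

lemma restrict_in_analytic_space:
  assumes "f holomorphic_on C_plus"
  shows "restrict f C_plus \<in> analytic_space"
proof -
  have "restrict f C_plus holomorphic_on C_plus"
    using assms by (rule holomorphic_transform) simp
  then show ?thesis
    by (simp add: analytic_space_def analytic_on_open)
qed

text \<open>The Schwarz lemma for the Cayley transform of \<open>F\<close> gives
  \<open>norm (F w - F z) \<le> r * norm (F w + cnj (F z))\<close> with
  \<open>r = dist w z / \<delta>\<close>. The triangle inequality bounds the last norm by
  \<open>norm (F w - F z) + 2 * Re (F z)\<close>, and collecting the terms in
  \<open>F w - F z\<close> gives the claim in division-free form.\<close>

lemma half_plane_schwarz: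
  assumes hol: "F holomorphic_on ball z \<delta>" and pos: "\<And>w. w \<in> ball z \<delta> \<Longrightarrow> Re (F w) > 0"
    and w: "w \<in> ball z \<delta>"
  shows "dist (F w) (F z) * (\<delta> - dist w z) \<le> 2 * Re (F z) * dist w z"
proof -
  have \<delta>: "\<delta> > 0" using w by (metis dist_not_less_zero linorder_neqE_linordered_idom mem_ball order_less_trans)
  define a where "a = F z"
  \<comment> \<open>\<open>F\<close> rescaled to the unit disc, followed by the Moebius map that
    takes the right half-plane to the unit disc and \<open>a\<close> to 0.\<close>
  define g where "g = (\<lambda>u. (F (z + of_real \<delta> * u) - a) / (F (z + of_real \<delta> * u) + cnj a))"
  have mem: "z + of_real \<delta> * u \<in> ball z \<delta>" if "u \<in> ball 0 1" for u
    using that \<delta> by (simp add: dist_norm norm_mult)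
  have apos: "Re a > 0" using pos[of z] \<delta> by (simp add: a_def)
  have ne: "v + cnj a \<noteq> 0" if "Re v > 0" for v
    using that apos by (auto simp: complex_eq_iff)
  have cayley: "norm (v - a) < norm (v + cnj a)" if v: "Re v > 0" for v
  proof -
    \<comment> \<open>The two sides differ by \<open>4 * Re v * Re a\<close>.\<close>
    have "(Re v - Re a)\<^sup>2 + (Im v - Im a)\<^sup>2 < (Re v + Re a)\<^sup>2 + (Im v - Im a)\<^sup>2"
      using mult_pos_pos[OF v apos] by (simp add: power2_eq_square algebra_simps)
    then show ?thesis by (simp add: cmod_def)
  qed
  have ghol: "g holomorphic_on ball 0 1"
  proof -
    have "F \<circ> (\<lambda>u. z + of_real \<delta> * u) holomorphic_on ball 0 1"
      by (rule holomorphic_on_compose_gen[OF _ hol]) (use mem in \<open>auto intro!: holomorphic_intros\<close>)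
    then show ?thesis unfolding g_def o_def
      by (intro holomorphic_intros) (use ne mem pos in auto)
  qed
  have g0: "g 0 = 0" by (simp add: g_def a_def)
  have g1: "norm (g u) < 1" if "norm u < 1" for u
    using cayley[OF pos[OF mem]] that ne[OF pos[OF mem]] by (simp add: g_def norm_divide)
  define u where "u = (w - z) / of_real \<delta>"
  have u: "norm u = dist w z / \<delta>" "norm u < 1" "z + of_real \<delta> * u = w"
    using w \<delta> by (simp_all add: u_def norm_divide dist_norm norm_minus_commute)
  have gu: "norm (g u) \<le> norm u"
    by (rule Schwarz_Lemma(1)[OF ghol g0 g1 u(2)])
  have "F w - a = g u * (F w + cnj a)"
    using ne[OF pos[OF w]] u(3) by (simp add: g_def)
  then have "norm (F w - a) \<le> norm u * norm (F w + cnj a)"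
    using gu by (simp add: norm_mult mult_right_mono)
  also have "F w + cnj a = (F w - a) + of_real (2 * Re a)"
    by (simp add: complex_eq_iff)
  also have "norm u * norm \<dots> \<le> norm u * (norm (F w - a) + 2 * Re a)"
    using norm_triangle_ineq[of "F w - a" "of_real (2 * Re a)"] apos
    by (intro mult_left_mono) (simp_all del: of_real_mult)
  finally have "\<delta> * norm (F w - a) \<le> \<delta> * (norm u * (norm (F w - a) + 2 * Re a))"
    using \<delta> by (intro mult_left_mono) simp_all
  also have "\<dots> = dist w z * (norm (F w - a) + 2 * Re a)"
    using \<delta> u(1) by simp
  finally show ?thesis
    by (simp add: a_def dist_norm algebra_simps)
qed

text \<open>The disc of radius \<open>\<delta>\<close> about \<open>s + \<delta>\<close> stays in
  \<open>C_plus\<close> for every \<open>s\<close> in \<open>C_plus\<close>, so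
  \<open>half_plane_schwarz\<close> applies with one radius throughout; on \<open>S\<close> its
  factor \<open>Re (F z)\<close> is below \<open>M\<close>, which makes the modulus of continuity
  independent of \<open>s\<close>.\<close>

lemma uniformly_continuous_on_translate:
  assumes hol: "\<Phi> holomorphic_on C_plus" and pos: "\<Phi> ` C_plus \<subseteq> C_plus"
    and \<delta>: "\<delta> > 0" and M: "M > 0"
    and S: "S \<subseteq> {s \<in> C_plus. Re (\<Phi> (s + of_real \<delta>)) < M}"
  shows "uniformly_continuous_on S (\<lambda>s. \<Phi> (s + of_real \<delta>))"
  unfolding uniformly_continuous_on_def
proof (intro allI impI)
  fix e :: real assume e: "e > 0"
  \<comment> \<open>The first bound keeps \<open>\<delta> - dist w z\<close> above
    \<open>\<delta> / 2\<close>; the second makes \<open>2 * M * d\<close> at most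
    \<open>e * \<delta> / 4\<close>, strictly below the \<open>e * \<delta> / 2\<close> needed at
    the end.\<close>
  define d where "d = min (\<delta> / 2) (e * \<delta> / (8 * M))"
  have d: "d > 0" using \<delta> M e by (simp add: d_def)
  have "dist (\<Phi> (t + of_real \<delta>)) (\<Phi> (s + of_real \<delta>)) < e"
    if s: "s \<in> S" and st: "dist t s < d" for s t
  proof -
    define z w where "z = s + of_real \<delta>" and "w = t + of_real \<delta>"
    have ball: "ball z \<delta> \<subseteq> C_plus"
    proof
      fix v assume "v \<in> ball z \<delta>"
      \<comment> \<open>This suffices because
        \<open>Re z = Re s + \<delta> > \<delta>\<close>.\<close>
      then have "\<bar>Re (z - v)\<bar> < \<delta>"
        using abs_Re_le_cmod[of "z - v"] by (simp add: dist_norm)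
      then show "v \<in> C_plus" using s S by (auto simp: half_plane_def z_def)
    qed
    have wz: "dist w z < d" using st by (simp add: w_def z_def)
    then have wz2: "dist w z < \<delta> / 2" by (simp add: d_def)
    have "dist (\<Phi> w) (\<Phi> z) * (\<delta> / 2) \<le> dist (\<Phi> w) (\<Phi> z) * (\<delta> - dist w z)"
      using wz2 by (intro mult_left_mono) simp_all
    also have "\<dots> \<le> 2 * Re (\<Phi> z) * dist w z"
    proof (rule half_plane_schwarz)
      show "\<Phi> holomorphic_on ball z \<delta>" using hol ball by (rule holomorphic_on_subset)
      show "Re (\<Phi> v) > 0" if "v \<in> ball z \<delta>" for v
        using pos ball that by (force simp: half_plane_def)
      show "w \<in> ball z \<delta>" using wz2 \<delta> by (simp add: dist_commute)
    qed
    also have "\<dots> \<le> 2 * M * d"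
    proof (rule mult_mono)
      show "2 * Re (\<Phi> z) \<le> 2 * M" using s S by (auto simp: z_def)
    qed (use wz M in simp_all)
    also have "\<dots> \<le> 2 * M * (e * \<delta> / (8 * M))"
      using M by (intro mult_left_mono) (simp_all add: d_def)
    also have "\<dots> < e * (\<delta> / 2)" using M e \<delta> by simp
    finally show ?thesis
      using \<delta> by (simp add: w_def z_def)
  qed
  then show "\<exists>d>0. \<forall>x\<in>S. \<forall>x'\<in>S. dist x' x < d \<longrightarrow>
      dist (\<Phi> (x' + of_real \<delta>)) (\<Phi> (x + of_real \<delta>)) < e"
    using d by blast
qed

lemma translate_in_C_plus:
  assumes "s \<in> C_plus" "\<delta> \<ge> 0"
  shows "s + of_real \<delta> \<in> C_plus"
  using assms by (simp add: half_plane_def)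

lemma holomorphic_on_translate:
  assumes "f holomorphic_on C_plus" "\<delta> \<ge> 0"
  shows "(\<lambda>s. f (s + of_real \<delta>)) holomorphic_on C_plus"
proof -
  have "f \<circ> (\<lambda>s. s + of_real \<delta>) holomorphic_on C_plus"
    by (rule holomorphic_on_compose_gen[OF _ assms(1)])
       (use assms translate_in_C_plus in \<open>auto intro!: holomorphic_intros\<close>)
  then show ?thesis by (simp add: o_def)
qed

lemma analytic_space_holomorphic: "f \<in> analytic_space \<Longrightarrow> f holomorphic_on C_plus"
  by (simp add: analytic_space_def analytic_imp_holomorphic)

text \<open>Translation multiplies the \<open>n\<close>-th coefficient by
  \<open>n powr (- \<delta>)\<close>, and a constant is the term \<open>n = 1\<close> of a Dirichlet
  series. The constant \<open>b\<close> makes room for the \<open>c * \<delta>\<close> that arises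
  when \<open>c * s\<close> is translated.\<close>

lemma Dirichlet_class_translate:
  assumes \<phi>: "\<phi> \<in> Dirichlet_class" and \<delta>: "\<delta> \<ge> 0"
  shows "restrict (\<lambda>s. \<phi> (s + of_real \<delta>) + b) C_plus \<in> Dirichlet_class"
proof -
  obtain a \<theta> where \<theta>: "\<theta> \<ge> 0"
    and a: "\<And>s. s \<in> half_plane \<theta> \<Longrightarrow> (\<lambda>n. a (Suc n) * of_nat (Suc n) powr (- s)) sums \<phi> s"
    and an: "\<phi> \<in> analytic_space"
    using \<phi> by (auto simp: Dirichlet_class_def)
  \<comment> \<open>The \<open>b\<close> sits at index 1, which is index 0 in the shifted sums
    below.\<close>
  define a' where "a' = (\<lambda>n. a n * of_nat n powr (- of_real \<delta>) + (if n = 1 then b else 0))"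
  have "(\<lambda>n. a' (Suc n) * of_nat (Suc n) powr (- s)) sums restrict (\<lambda>s. \<phi> (s + of_real \<delta>) + b) C_plus s"
    if s: "s \<in> half_plane \<theta>" for s
  proof -
    \<comment> \<open>Moving to the right stays inside \<open>half_plane \<theta>\<close>, so the
      same \<open>\<theta>\<close> serves the translated series.\<close>
    have mem: "s + of_real \<delta> \<in> half_plane \<theta>" "s \<in> C_plus"
      using s \<theta> \<delta> by (simp_all add: half_plane_def)
    have "(\<lambda>n. if n = 0 then b else 0) sums b"
      using sums_single[of 0 "\<lambda>_. b"] by simp
    then have "(\<lambda>n. a (Suc n) * of_nat (Suc n) powr (- (s + of_real \<delta>)) + (if n = 0 then b else 0))
        sums restrict (\<lambda>s. \<phi> (s + of_real \<delta>) + b) C_plus s"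
      using sums_add[OF a[OF mem(1)]] mem(2) by (simp del: of_nat_Suc)
    moreover have "a (Suc n) * of_nat (Suc n) powr (- (s + of_real \<delta>)) + (if n = 0 then b else 0)
        = a' (Suc n) * of_nat (Suc n) powr (- s)" for n
    proof -
      have "of_nat (Suc n) powr (- (s + of_real \<delta>))
          = of_nat (Suc n) powr (- of_real \<delta>) * of_nat (Suc n) powr (- s)"
        by (simp only: powr_add[symmetric] minus_add_distrib add.commute)
      then show ?thesis
        by (simp add: a'_def distrib_right mult.assoc del: of_nat_Suc) (simp add: of_nat_Suc)
    qed
    ultimately show ?thesis by (simp only:)
  qed
  moreover have "restrict (\<lambda>s. \<phi> (s + of_real \<delta>) + b) C_plus \<in> analytic_space"
    by (intro restrict_in_analytic_space holomorphic_intros holomorphic_on_translate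
        analytic_space_holomorphic an \<delta>)
  ultimately show ?thesis
    using \<theta> unfolding Dirichlet_class_def by blast
qed

lemma translate_in_G_A:
  assumes \<Phi>: "\<Phi> \<in> G_infinity" and \<delta>: "\<delta> > 0"
  shows "restrict (\<lambda>s. \<Phi> (s + of_real \<delta>)) C_plus \<in> G_A"
proof -
  let ?\<Psi> = "restrict (\<lambda>s. \<Phi> (s + of_real \<delta>)) C_plus"
  obtain c \<phi> where \<phi>: "\<phi> \<in> Dirichlet_class" and eq: "\<And>s. s \<in> C_plus \<Longrightarrow> \<Phi> s = of_nat c * s + \<phi> s"
    and an: "\<Phi> \<in> analytic_space" and pos: "\<Phi> ` C_plus \<subseteq> C_plus"
    using \<Phi> unfolding G_infinity_def by blast
  note hol = analytic_space_holomorphic[OF an]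
  have tr: "s + of_real \<delta> \<in> C_plus" if "s \<in> C_plus" for s
    using translate_in_C_plus that \<delta> by simp
  have "?\<Psi> \<in> analytic_space"
    using hol \<delta> by (intro restrict_in_analytic_space holomorphic_on_translate) simp_all
  moreover have "?\<Psi> ` C_plus \<subseteq> C_plus"
    using pos tr by auto
  moreover have "restrict (\<lambda>s. \<phi> (s + of_real \<delta>) + of_nat c * of_real \<delta>) C_plus \<in> Dirichlet_class"
    using \<phi> \<delta> by (intro Dirichlet_class_translate) simp_all
  moreover have "\<forall>s\<in>C_plus. ?\<Psi> s = of_nat c * s
      + restrict (\<lambda>s. \<phi> (s + of_real \<delta>) + of_nat c * of_real \<delta>) C_plus s"
    using eq tr by (simp add: algebra_simps)
  ultimately have "?\<Psi> \<in> G_infinity"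
    unfolding G_infinity_def by blast
  moreover have "uniformly_continuous_on {s \<in> C_plus. 0 < Re (?\<Psi> s) \<and> Re (?\<Psi> s) < M} ?\<Psi>"
    (is "uniformly_continuous_on ?A _") if "M > 0" for M
  proof -
    \<comment> \<open>On \<open>?A\<close>, a subset of \<open>C_plus\<close>, the restriction
      agrees with the bare translate, to which the lemma applies.\<close>
    have "uniformly_continuous_on ?A (\<lambda>s. \<Phi> (s + of_real \<delta>))"
      using hol pos \<delta> that by (rule uniformly_continuous_on_translate) auto
    then show ?thesis
      unfolding uniformly_continuous_on_def by simp
  qed
  ultimately show ?thesis
    by (simp add: G_A_def)
qed

text \<open>Uniform continuity on \<open>K\<close> alone would not do, since the translated points
  may leave \<open>K\<close>; it is taken on a larger compact set instead.\<close>

lemma uniformly_close_translate: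
  assumes f: "continuous_on C_plus f" and K: "compact K" "K \<subseteq> C_plus" and e: "e > 0"
  obtains \<delta> where "\<delta> > 0" "\<And>s. s \<in> K \<Longrightarrow> dist (f (s + of_real \<delta>)) (f s) < e"
proof -
  \<comment> \<open>The set swept out by \<open>K\<close> under translations by real numbers in
    \<open>[0, 1]\<close>.\<close>
  define L where "L = {x + y | x y. x \<in> K \<and> y \<in> of_real ` {0..1::real}}"
  have "compact L"
    unfolding L_def
    by (intro compact_sums K compact_continuous_image continuous_intros) auto
  moreover have LC: "L \<subseteq> C_plus"
    using K(2) translate_in_C_plus by (auto simp: L_def)
  ultimately have "uniformly_continuous_on L f"
    using compact_uniformly_continuous continuous_on_subset f by blast
  then obtain d where d: "d > 0" "\<And>x y. x \<in> L \<Longrightarrow> y \<in> L \<Longrightarrow> dist y x < d \<Longrightarrow> dist (f y) (f x) < e"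
    using e unfolding uniformly_continuous_on_def by metis
  \<comment> \<open>The cap 1 keeps \<open>s + \<delta>\<close> in \<open>L\<close>; halving
    \<open>d\<close> makes the distance strictly less than \<open>d\<close>.\<close>
  define \<delta> where "\<delta> = min 1 (d / 2)"
  show ?thesis
  proof
    show "\<delta> > 0" using d by (simp add: \<delta>_def)
    fix s assume s: "s \<in> K"
    have mem: "s + of_real r \<in> L" if "0 \<le> r" "r \<le> 1" for r
      using s that unfolding L_def by force
    show "dist (f (s + of_real \<delta>)) (f s) < e"
    proof (rule d(2))
      show "s \<in> L" using mem[of 0] by simp
      show "s + of_real \<delta> \<in> L" using d(1) by (intro mem) (auto simp: \<delta>_def)
      show "dist (s + of_real \<delta>) s < d" using d(1) by (simp add: dist_norm \<delta>_def)
    qed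
  qed
qed

theorem theorem4p5:
  shows "compact_convergence closure_of G_A = compact_convergence closure_of G_infinity"
proof
  show "compact_convergence closure_of G_A \<subseteq> compact_convergence closure_of G_infinity"
    by (intro closure_of_mono) (auto simp: G_A_def)
  \<comment> \<open>This is enough: the right-hand side is closed, so it then contains the closure
    of \<open>G_infinity\<close>.\<close>
  have "G_infinity \<subseteq> compact_convergence closure_of G_A"
  proof
    fix \<Phi> assume \<Phi>: "\<Phi> \<in> G_infinity"
    then have an: "\<Phi> \<in> analytic_space" by (simp add: G_infinity_def)
    have "\<exists>g\<in>G_A \<inter> analytic_space. \<forall>s\<in>K. dist (g s) (\<Phi> s) < e"
      if K: "compact K" "K \<subseteq> C_plus" "e > 0" for K e
    proof -
      obtain \<delta> where \<delta>: "\<delta> > 0" "\<And>s. s \<in> K \<Longrightarrow> dist (\<Phi> (s + of_real \<delta>)) (\<Phi> s) < e"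
        using uniformly_close_translate K an analytic_space_holomorphic
          holomorphic_on_imp_continuous_on by metis
      let ?\<Psi> = "restrict (\<lambda>s. \<Phi> (s + of_real \<delta>)) C_plus"
      have "?\<Psi> \<in> G_A" using \<Phi> \<delta>(1) by (rule translate_in_G_A)
      then have "?\<Psi> \<in> G_A \<inter> analytic_space" by (simp add: G_A_def G_infinity_def)
      moreover have "\<forall>s\<in>K. dist (?\<Psi> s) (\<Phi> s) < e"
        using \<delta>(2) K(2) by (simp add: subset_iff)
      ultimately show ?thesis by blast
    qed
    then show "\<Phi> \<in> compact_convergence closure_of G_A"
      using an by (simp add: in_closure_of_compact_convergence)
  qed
  then show "compact_convergence closure_of G_infinity \<subseteq> compact_convergence closure_of G_A"
    by (simp add: closure_of_minimal)
qed

end
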